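(* For every DAG $G$ the following are equivalent: (1) $G$ has the global lca-property; (2) $\mathrm{lxt}(G)$ has the global lca-property; (3) $\mathrm{lxt}(G)$ has the global pairwise-lca-property; (4) $\mathrm{lxt}(G)$ has the lca-property; (5) $\mathrm{lxt}(G)$ has the pairwise-lca-property; (6) $\mathfrak{C}_{\mathrm{lxt}(G)}$ is a closed clustering system; (7) $\mathfrak{C}_{\mathrm{lxt}(G)}$ is a pre-binary clustering system.
   Context: A DAG is a finite directed graph without loops and directed cycles; $u\preceq_G v$ means there is a directed path from $v$ to $u$ (including $u=v$). $L(G)$ is the set of $\preceq_G$-minimal vertices (leaves); inner vertices are those not in $L(G)$. For non-empty $A\subseteq V(G)$, $\mathrm{LCA}_G(A)$ is the set of $\preceq_G$-minimal vertices $v$ with $a\preceq_G v$ for all $a\in A$. $G$ has: the global lca-property if $|\mathrm{LCA}_G(A)|=1$ for all non-empty $A\subseteq V(G)$; the global pairwise-lca-property if this holds for all $A\subseteq V(G)$ with $|A|=2$; the lca-property if this holds for all non-empty $A\subseteq L(G)$; the pairwise-lca-property if this holds for all $A\subseteq L(G)$ with $|A|=2$. The cluster of $v$ is $C_G(v)=\{x\in L(G): x\preceq_G v\}$ and $\mathfrak{C}_G=\{C_G(v):v\in V(G)\}$. A set system on $X$ is a subset of $2^X$; it is a clustering system if it contains $X$, contains $\{x\}$ for all $x\in X$, and does not contain $\emptyset$. A set system $\mathfrak{C}$ is closed if $A,B\in\mathfrak{C}$ implies $A\cap B\in\mathfrak{C}$ or $A\cap B=\emptyset$. A clustering system $\mathfrak{C}$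 on $X$ is pre-binary if for all $x,y\in X$ there is a unique inclusion-minimal $C\in\mathfrak{C}$ containing $x$ and $y$. The leaf-extended DAG $\mathrm{lxt}(G)$ is obtained from $G$ by adding, for every inner vertex $v$ of $G$, a new vertex $x_v$ and the edge $(v,x_v)$. *)

theory Defs
  imports "Graph_Theory.Graph_Theory"
begin

text \<open>
  A DAG is a digraph (finite, loop-free, no parallel arcs) without directed cycles. The vertex
  set of a graph is required to be non-empty, which Graph Theory's locale \<open>pair_digraph\<close> does
  not do. For the null graph, the set of clusters is empty, so it does not contain the ground
  set and is no clustering system, whereas all the lca-properties hold vacuously.
\<close>

locale dag = pair_digraph +
  assumes verts_nonempty: "pverts G \<noteq> {}"
    and no_cycle: "\<not> (\<exists>p. cycle p)"

definition minimal_elems :: "('a \<Rightarrow> 'a \<Rightarrow> bool) \<Rightarrow> 'a set \<Rightarrow> 'a set" where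
  "minimal_elems r S = {m \<in> S. \<forall>x \<in> S. r x m \<longrightarrow> x = m}"

text \<open>
  Arcs point from ancestors to descendants: \<open>u\<close> is below \<open>v\<close> if \<open>u\<close> can be reached from \<open>v\<close>.
\<close>

definition below :: "'a pair_pre_digraph \<Rightarrow> 'a \<Rightarrow> 'a \<Rightarrow> bool" where
  "below G u v \<longleftrightarrow> v \<rightarrow>\<^sup>*\<^bsub>with_proj G\<^esub> u"

definition leaves :: "'a pair_pre_digraph \<Rightarrow> 'a set" where
  "leaves G = minimal_elems (below G) (pverts G)"

definition inner_verts :: "'a pair_pre_digraph \<Rightarrow> 'a set" where
  "inner_verts G = pverts G - leaves G"

definition LCA :: "'a pair_pre_digraph \<Rightarrow> 'a set \<Rightarrow> 'a set" where
  "LCA G A = minimal_elems (below G) {v \<in> pverts G. \<forall>a \<in> A. below G a v}"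

definition global_lca_property :: "'a pair_pre_digraph \<Rightarrow> bool" where
  "global_lca_property G \<longleftrightarrow> (\<forall>A \<subseteq> pverts G. A \<noteq> {} \<longrightarrow> card (LCA G A) = 1)"

definition global_pairwise_lca_property :: "'a pair_pre_digraph \<Rightarrow> bool" where
  "global_pairwise_lca_property G \<longleftrightarrow> (\<forall>A \<subseteq> pverts G. card A = 2 \<longrightarrow> card (LCA G A) = 1)"

definition lca_property :: "'a pair_pre_digraph \<Rightarrow> bool" where
  "lca_property G \<longleftrightarrow> (\<forall>A \<subseteq> leaves G. A \<noteq> {} \<longrightarrow> card (LCA G A) = 1)"

definition pairwise_lca_property :: "'a pair_pre_digraph \<Rightarrow> bool" where
  "pairwise_lca_property G \<longleftrightarrow> (\<forall>A \<subseteq> leaves G. card A = 2 \<longrightarrow> card (LCA G A) = 1)"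

definition cluster :: "'a pair_pre_digraph \<Rightarrow> 'a \<Rightarrow> 'a set" where
  "cluster G v = {x \<in> leaves G. below G x v}"

definition clusters :: "'a pair_pre_digraph \<Rightarrow> 'a set set" where
  "clusters G = cluster G ` pverts G"

definition clustering_system :: "'a set \<Rightarrow> 'a set set \<Rightarrow> bool" where
  "clustering_system X \<CC> \<longleftrightarrow> \<CC> \<subseteq> Pow X \<and> X \<in> \<CC> \<and> (\<forall>x \<in> X. {x} \<in> \<CC>) \<and> {} \<notin> \<CC>"

definition closed_system :: "'a set set \<Rightarrow> bool" where
  "closed_system \<CC> \<longleftrightarrow> (\<forall>A \<in> \<CC>. \<forall>B \<in> \<CC>. A \<inter> B \<in> \<CC> \<or> A \<inter> B = {})"

definition pre_binary :: "'a set \<Rightarrow> 'a set set \<Rightarrow> bool" where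
  "pre_binary X \<CC> \<longleftrightarrow>
    (\<forall>x \<in> X. \<forall>y \<in> X. \<exists>!C. C \<in> minimal_elems (\<subseteq>) {C \<in> \<CC>. x \<in> C \<and> y \<in> C})"

text \<open>
  The leaf-extended DAG: \<open>Inl v\<close> is the original vertex \<open>v\<close>, and \<open>Inr v\<close> is the new vertex
  attached below the inner vertex \<open>v\<close>.
\<close>

definition lxt :: "'a pair_pre_digraph \<Rightarrow> ('a + 'a) pair_pre_digraph" where
  "lxt G = \<lparr> pverts = Inl ` pverts G \<union> Inr ` inner_verts G,
             parcs = map_prod Inl Inl ` parcs G \<union> {(Inl v, Inr v) | v. v \<in> inner_verts G} \<rparr>"

end

theory Submission
  imports Defs
begin

text \<open>
  Identify the leaves of \<open>lxt G\<close> with the vertices of \<open>G\<close>, an inner vertex \<open>v\<close> corresponding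
  to its attached leaf \<open>Inr v\<close>. Under this identification the clusters of \<open>lxt G\<close> are the
  principal ideals of the order on \<open>G\<close>, together with all singletons, and the common ancestors
  in \<open>lxt G\<close> of a set that is not a single new leaf are those in \<open>G\<close>. So every one of the
  conditions says that any two vertices of \<open>G\<close> have a join. For closedness, use that a finite
  poset with a top element has all binary joins iff any two elements with a common lower bound
  have a meet.
\<close>

section \<open>Minimal and least elements of finite orders\<close>

text \<open>In a finite order every element lies above some minimal one, so if only one minimal
  element exists it lies below everything. The order laws are relativised to \<open>S\<close>
  because \<open>below G\<close> is reflexive on vertices only.\<close>

lemma ex1_minimal_elems_iff:
  assumes "finite S" and refl: "\<And>x. x \<in> S \<Longrightarrow> r x x"
    and trans: "\<And>x y z. \<lbrakk>x \<in> S; y \<in> S; z \<in> S; r x y; r y z\<rbrakk> \<Longrightarrow> r x z"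
    and antisym: "\<And>x y. \<lbrakk>x \<in> S; y \<in> S; r x y; r y x\<rbrakk> \<Longrightarrow> x = y"
  shows "(\<exists>!m. m \<in> minimal_elems r S) \<longleftrightarrow> (\<exists>m \<in> S. \<forall>x \<in> S. r m x)"
proof
  assume "\<exists>!m. m \<in> minimal_elems r S"
  then obtain m where m: "m \<in> minimal_elems r S"
    and uniq: "\<And>n. n \<in> minimal_elems r S \<Longrightarrow> n = m" by blast
  have "r m x" if x: "x \<in> S" for x
  proof -
    \<comment> \<open>A minimal element below \<open>x\<close> is sought within \<open>?A\<close>,
      for the strict part \<open>?R\<close> of the order. It is minimal in all of \<open>S\<close>,
      since whatever lies below it lies below \<open>x\<close> and so belongs to
      \<open>?A\<close>.\<close>
    let ?A = "{y \<in> S. r y x}" and ?R = "\<lambda>y z. r y z \<and> y \<noteq> z"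
    have "asymp_on ?A ?R" by (auto intro!: asymp_onI dest: antisym)
    moreover have "transp_on ?A ?R"
    proof (rule transp_onI)
      fix u v w assume "u \<in> ?A" "v \<in> ?A" "w \<in> ?A" "?R u v" "?R v w"
      then show "?R u w" using trans[of u v w] antisym[of u v] by blast
    qed
    moreover have "finite ?A" "?A \<noteq> {}" using \<open>finite S\<close> x refl by auto
    ultimately obtain n where n: "n \<in> ?A" and min: "\<And>y. \<lbrakk>y \<in> ?A; y \<noteq> n\<rbrakk> \<Longrightarrow> \<not> ?R y n"
      using Finite_Set.bex_min_element[of ?A ?R] by blast
    have "n \<in> minimal_elems r S"
      unfolding minimal_elems_def
    proof (intro CollectI conjI ballI impI)
      show "n \<in> S" using n by blast
      fix y assume y: "y \<in> S" "r y n"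
      with n x have "y \<in> ?A" using trans[of y n x] by blast
      then show "y = n" using min y by blast
    qed
    with uniq n show ?thesis by blast
  qed
  with m show "\<exists>m \<in> S. \<forall>x \<in> S. r m x" by (auto simp: minimal_elems_def)
next
  assume "\<exists>m \<in> S. \<forall>x \<in> S. r m x"
  then obtain m where m: "m \<in> S" "\<And>x. x \<in> S \<Longrightarrow> r m x" by blast
  then have "minimal_elems r S = {m}"
    unfolding minimal_elems_def using antisym[of m] antisym[of _ m] by auto
  then show "\<exists>!m. m \<in> minimal_elems r S" by simp
qed

text \<open>Trades unique minimality for being the least cluster, a form that can be compared
  directly with joins and transported along injections.\<close>

lemma pre_binary_iff:
  assumes "finite \<CC>"
  shows "pre_binary X \<CC> \<longleftrightarrow>
    (\<forall>x \<in> X. \<forall>y \<in> X. \<exists>C \<in> \<CC>. x \<in> C \<and> y \<in> C \<and> (\<forall>D \<in> \<CC>. x \<in> D \<and> y \<in> D \<longrightarrow> C \<subseteq> D))"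
proof -
  have "(\<exists>!C. C \<in> minimal_elems (\<subseteq>) {C \<in> \<CC>. x \<in> C \<and> y \<in> C}) \<longleftrightarrow>
      (\<exists>C \<in> {C \<in> \<CC>. x \<in> C \<and> y \<in> C}. \<forall>D \<in> {C \<in> \<CC>. x \<in> C \<and> y \<in> C}. C \<subseteq> D)" for x y
    using assms by (intro ex1_minimal_elems_iff) auto
  then show ?thesis by (simp only: pre_binary_def mem_Collect_eq Bex_def Ball_def conj_assoc imp_conjL)
qed

section \<open>Transport of set systems along an injection of the ground set\<close>

lemma clustering_system_image_iff:
  assumes "inj f"
  shows "clustering_system (f ` X) ((`) f ` \<CC>) \<longleftrightarrow> clustering_system X \<CC>"
proof -
  have mem: "f ` A \<in> (`) f ` \<CC> \<longleftrightarrow> A \<in> \<CC>" for A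
    using inj_image_eq_iff[OF assms] by auto
  have "{f x} \<in> (`) f ` \<CC> \<longleftrightarrow> {x} \<in> \<CC>" for x using mem[of "{x}"] by simp
  moreover have "(`) f ` \<CC> \<subseteq> Pow (f ` X) \<longleftrightarrow> \<CC> \<subseteq> Pow X"
    unfolding image_subset_iff[of "(`) f"] Pow_iff inj_image_subset_iff[OF assms]
    by (simp only: subset_eq[of \<CC>] Pow_iff)
  moreover have "{} \<in> (`) f ` \<CC> \<longleftrightarrow> {} \<in> \<CC>" using mem[of "{}"] by simp
  ultimately show ?thesis unfolding clustering_system_def using mem[of X] by simp
qed

lemma closed_system_image_iff:
  assumes "inj f"
  shows "closed_system ((`) f ` \<CC>) \<longleftrightarrow> closed_system \<CC>"
proof -
  have "f ` A \<in> (`) f ` \<CC> \<longleftrightarrow> A \<in> \<CC>" for A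
    using inj_image_eq_iff[OF assms] by auto
  then show ?thesis
    unfolding closed_system_def by (simp flip: image_Int[OF assms])
qed

lemma pre_binary_image_iff:
  assumes "inj f" "finite \<CC>"
  shows "pre_binary (f ` X) ((`) f ` \<CC>) \<longleftrightarrow> pre_binary X \<CC>"
  unfolding pre_binary_iff[OF assms(2)] pre_binary_iff[OF finite_imageI[OF assms(2)]]
  by (simp only: ball_simps bex_simps inj_image_mem_iff[OF assms(1)]
      inj_image_subset_iff[OF assms(1)])

section \<open>Restricting the sets quantified over in the lca-properties\<close>

lemma global_lca_imp_lca_property: "global_lca_property G \<Longrightarrow> lca_property G"
  unfolding global_lca_property_def lca_property_def leaves_def minimal_elems_def by blast

lemma global_lca_imp_global_pairwise: "global_lca_property G \<Longrightarrow> global_pairwise_lca_property G"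
  unfolding global_lca_property_def global_pairwise_lca_property_def
  by (metis card.empty zero_neq_numeral)

lemma lca_property_imp_pairwise: "lca_property G \<Longrightarrow> pairwise_lca_property G"
  unfolding lca_property_def pairwise_lca_property_def
  by (metis card.empty zero_neq_numeral)

lemma global_pairwise_imp_pairwise: "global_pairwise_lca_property G \<Longrightarrow> pairwise_lca_property G"
  unfolding global_pairwise_lca_property_def pairwise_lca_property_def leaves_def minimal_elems_def
  by blast

text \<open>Inside the locale \<open>inner_verts\<close> unqualified means the inner vertices of a walk.\<close>

abbreviation (in dag) inner :: "'a set" where
  "inner \<equiv> Defs.inner_verts G"

section \<open>The reachability order of a DAG and its joins\<close>

lemma (in dag) below_verts: "below G u v \<Longrightarrow> u \<in> pverts G \<and> v \<in> pverts G"
  unfolding below_def using reachable_in_verts by blast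

lemma (in dag) below_refl: "v \<in> pverts G \<Longrightarrow> below G v v"
  unfolding below_def by simp

lemma (in dag) below_trans: "\<lbrakk>below G u v; below G v w\<rbrakk> \<Longrightarrow> below G u w"
  unfolding below_def using reachable_trans by blast

text \<open>Acyclicity enters here: two distinct mutually reachable vertices would lie on a closed
  walk, and a closed walk yields a cycle.\<close>

lemma (in dag) below_antisym:
  assumes "below G u v" "below G v u"
  shows "u = v"
proof (rule ccontr)
  assume "u \<noteq> v"
  with assms have "(u, v) \<in> (parcs G)\<^sup>+" "(v, u) \<in> (parcs G)\<^sup>+"
    unfolding below_def by (auto dest: reachable_neq_reachable1)
  then have "(u, u) \<in> (parcs G)\<^sup>+" by (rule trancl_trans)
  then obtain p where "awalk u p u" "p \<noteq> []" using reachable1_awalk by blast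
  then have "closed_w p" unfolding closed_w_def by auto
  then show False using closed_w_imp_cycle no_cycle by blast
qed

definition (in dag) is_lub :: "'a set \<Rightarrow> 'a \<Rightarrow> bool" where
  "is_lub A m \<longleftrightarrow> m \<in> pverts G \<and> (\<forall>a \<in> A. below G a m) \<and>
    (\<forall>v \<in> pverts G. (\<forall>a \<in> A. below G a v) \<longrightarrow> below G m v)"

text \<open>\<open>LCA G A\<close> consists of the minimal common upper bounds of \<open>A\<close>.
  As the vertex set is finite, there is exactly one of these iff there is a least common upper
  bound.\<close>

lemma (in dag) card_LCA_iff: "card (LCA G A) = 1 \<longleftrightarrow> (\<exists>m. is_lub A m)"
proof -
  let ?S = "{v \<in> pverts G. \<forall>a \<in> A. below G a v}"
  have "card (LCA G A) = 1 \<longleftrightarrow> (\<exists>!m. m \<in> minimal_elems (below G) ?S)"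
    unfolding LCA_def One_nat_def card_1_singleton_iff set_eq_iff by auto
  also have "\<dots> \<longleftrightarrow> (\<exists>m \<in> ?S. \<forall>x \<in> ?S. below G m x)"
    using pair_finite_verts
    by (intro ex1_minimal_elems_iff)
      (auto simp: below_refl dest: below_antisym below_trans)
  finally show ?thesis unfolding is_lub_def by blast
qed

lemma (in dag) is_lub_singleton: "v \<in> pverts G \<Longrightarrow> is_lub {v} v"
  unfolding is_lub_def by (simp add: below_refl)

lemma (in dag) is_lub_insert:
  assumes "is_lub A m" "is_lub {a, m} n"
  shows "is_lub (insert a A) n"
  using assms below_trans unfolding is_lub_def by blast

text \<open>Joins of finite non-empty sets are iterated binary joins. The degenerate pairs
  \<open>u = v\<close> may be included, as a vertex is its own join.\<close>

lemma (in dag) global_iff_pairwise_lub: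
  "global_lca_property G \<longleftrightarrow> (\<forall>u \<in> pverts G. \<forall>v \<in> pverts G. \<exists>m. is_lub {u, v} m)"
proof
  assume "global_lca_property G"
  then show "\<forall>u \<in> pverts G. \<forall>v \<in> pverts G. \<exists>m. is_lub {u, v} m"
    unfolding global_lca_property_def card_LCA_iff by simp
next
  assume pair: "\<forall>u \<in> pverts G. \<forall>v \<in> pverts G. \<exists>m. is_lub {u, v} m"
  have "\<exists>m. is_lub A m" if "A \<subseteq> pverts G" "A \<noteq> {}" for A
    using finite_subset[OF that(1) pair_finite_verts] that(2,1)
  proof (induction A rule: finite_ne_induct)
    case (singleton x)
    then show ?case using is_lub_singleton by auto
  next
    case (insert x A)
    then obtain m where m: "is_lub A m" by blast
    then have "m \<in> pverts G" unfolding is_lub_def by blast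
    with insert.prems pair obtain n where "is_lub {x, m} n" by blast
    with m show ?case using is_lub_insert by blast
  qed
  then show "global_lca_property G"
    unfolding global_lca_property_def card_LCA_iff by blast
qed

section \<open>Principal ideals and singletons as a set system\<close>

definition (in dag) down :: "'a \<Rightarrow> 'a set" where
  "down v = {u. below G u v}"

text \<open>The clusters of \<open>lxt G\<close> read on the vertices of \<open>G\<close>: an old
  vertex \<open>v\<close> gives \<open>down v\<close>, and an attached leaf gives
  \<open>{v}\<close>. For a leaf \<open>v\<close> of \<open>G\<close> both sets coincide, so the
  singletons may range over all vertices.\<close>

definition (in dag) ideals :: "'a set set" where
  "ideals = down ` pverts G \<union> (\<lambda>v. {v}) ` pverts G"

lemma (in dag) finite_ideals: "finite ideals"
  unfolding ideals_def using pair_finite_verts by simp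

lemma (in dag) mem_down_iff: "u \<in> down v \<longleftrightarrow> below G u v"
  unfolding down_def by simp

lemma (in dag) down_subset_verts: "down v \<subseteq> pverts G"
  unfolding down_def using below_verts by blast

lemma (in dag) down_mono_iff: "u \<in> pverts G \<Longrightarrow> down u \<subseteq> down v \<longleftrightarrow> below G u v"
  unfolding down_def using below_refl below_trans by blast

text \<open>All singletons belong to \<open>ideals\<close> and the empty set does not, so the one
  real condition is that the whole vertex set is a member, which means that a top vertex
  exists.\<close>

lemma (in dag) clustering_system_ideals_iff:
  "clustering_system (pverts G) ideals \<longleftrightarrow> (\<exists>t \<in> pverts G. \<forall>v \<in> pverts G. below G v t)"
proof
  assume "clustering_system (pverts G) ideals"
  then have "pverts G \<in> ideals" unfolding clustering_system_def by blast
  then obtain t where "t \<in> pverts G" "pverts G = down t \<or> pverts G = {t}"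
    unfolding ideals_def by blast
  then show "\<exists>t \<in> pverts G. \<forall>v \<in> pverts G. below G v t"
    using mem_down_iff below_refl by (metis singletonD)
next
  assume "\<exists>t \<in> pverts G. \<forall>v \<in> pverts G. below G v t"
  then obtain t where t: "t \<in> pverts G" "\<And>v. v \<in> pverts G \<Longrightarrow> below G v t" by blast
  then have "down t = pverts G" using down_subset_verts mem_down_iff by blast
  with t have "pverts G \<in> ideals" unfolding ideals_def by blast
  moreover have "{} \<notin> ideals"
    unfolding ideals_def using mem_down_iff below_refl by blast
  moreover have "ideals \<subseteq> Pow (pverts G)"
    unfolding ideals_def using down_subset_verts by blast
  ultimately show "clustering_system (pverts G) ideals"
    unfolding clustering_system_def by (auto simp: ideals_def)
qed

lemma (in dag) global_imp_clustering_system_ideals: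
  assumes "global_lca_property G"
  shows "clustering_system (pverts G) ideals"
proof -
  have "\<exists>t. is_lub (pverts G) t"
    using assms verts_nonempty unfolding global_lca_property_def card_LCA_iff by simp
  then show ?thesis unfolding clustering_system_ideals_iff is_lub_def by blast
qed

text \<open>If two principal ideals meet, let \<open>m\<close> be the join of all common lower
  bounds of their generators \<open>u\<close> and \<open>v\<close>. Both generators are upper bounds
  of these, so \<open>m\<close> is itself a common lower bound, hence the meet, and the intersection
  is \<open>down m\<close>.\<close>

lemma (in dag) global_imp_closed_ideals:
  assumes "global_lca_property G"
  shows "closed_system ideals"
  unfolding closed_system_def
proof (intro ballI)
  fix A B assume A: "A \<in> ideals" and B: "B \<in> ideals"
  show "A \<inter> B \<in> ideals \<or> A \<inter> B = {}"
  proof (cases "A \<in> down ` pverts G \<and> B \<in> down ` pverts G \<and> A \<inter> B \<noteq> {}")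
    case True
    then obtain u v where uv: "u \<in> pverts G" "v \<in> pverts G" "A = down u" "B = down v" by blast
    have "A \<inter> B \<subseteq> pverts G" using uv down_subset_verts by blast
    then obtain m where m: "is_lub (A \<inter> B) m"
      using assms True unfolding global_lca_property_def card_LCA_iff by blast
    then have "below G m u" "below G m v"
      using uv by (auto simp: is_lub_def mem_down_iff)
    then have "down m \<subseteq> A \<inter> B"
      unfolding uv by (simp add: down_mono_iff below_verts)
    moreover have "A \<inter> B \<subseteq> down m"
      using m by (simp add: is_lub_def mem_down_iff subset_iff)
    ultimately have "A \<inter> B = down m" by (rule subset_antisym[rotated])
    then show ?thesis using m unfolding ideals_def is_lub_def by blast
  next
    case False
    \<comment> \<open>Intersecting with a singleton gives the empty set or that singleton, which is
      already a member.\<close>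
    then have "(\<exists>x. A = {x}) \<or> (\<exists>x. B = {x}) \<or> A \<inter> B = {}"
      using A B unfolding ideals_def by blast
    then have "A \<inter> B = {} \<or> A \<inter> B = A \<or> A \<inter> B = B" by blast
    then show ?thesis using A B by metis
  qed
qed

text \<open>The join of \<open>u\<close> and \<open>v\<close> is obtained as the meet of their
  finitely many common upper bounds. Closedness supplies binary meets of elements with a common
  lower bound, and \<open>u\<close> is such a bound here.\<close>

lemma (in dag) clustering_closed_imp_global:
  assumes "clustering_system (pverts G) ideals" "closed_system ideals"
  shows "global_lca_property G"
  unfolding global_iff_pairwise_lub
proof (intro ballI)
  fix u v assume uv: "u \<in> pverts G" "v \<in> pverts G"
  obtain t where t: "t \<in> pverts G" "\<And>v. v \<in> pverts G \<Longrightarrow> below G v t"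
    using assms(1) unfolding clustering_system_ideals_iff by blast
  have meet: "\<exists>m \<in> pverts G. down x \<inter> down y = down m"
    if xy: "x \<in> pverts G" "y \<in> pverts G" and ne: "down x \<inter> down y \<noteq> {}" for x y
  proof -
    have "down x \<inter> down y \<in> ideals"
      using assms(2) xy ne unfolding closed_system_def ideals_def by blast
    then consider (down) m where "m \<in> pverts G" "down x \<inter> down y = down m"
      | (single) m where "m \<in> pverts G" "down x \<inter> down y = {m}"
      unfolding ideals_def by blast
    then show ?thesis
    proof cases
      case single
      \<comment> \<open>The intersection is downward closed, so when it is a singleton
        \<open>{m}\<close>, nothing else lies below \<open>m\<close> and \<open>{m}\<close> is the
        principal ideal of \<open>m\<close>.\<close>
      then have "below G m x" "below G m y" unfolding mem_down_iff[symmetric] by auto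
      then have "down m \<subseteq> down x \<inter> down y"
        using down_mono_iff[OF single(1)] by simp
      with single have "down m = {m}" using below_refl by (auto simp: mem_down_iff)
      with single show ?thesis by blast
    qed blast
  qed
  let ?U = "{w \<in> pverts G. below G u w \<and> below G v w}"
  \<comment> \<open>The lower bound is kept inside \<open>?U\<close>, so that \<open>u\<close> and
    \<open>v\<close> witness that the next intersection is non-empty. The top \<open>t\<close>
    serves \<open>F = {}\<close>, and \<open>F = ?U\<close> yields the join.\<close>
  have "\<exists>m \<in> ?U. \<forall>x \<in> F. below G m x" if "finite F" "F \<subseteq> ?U" for F
    using that
  proof (induction F rule: finite_induct)
    case empty
    then show ?case using t uv by blast
  next
    case (insert x F)
    then obtain m where m: "m \<in> ?U" "\<forall>y \<in> F. below G m y" by auto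
    have uv_mem: "u \<in> down x \<inter> down m" "v \<in> down x \<inter> down m"
      using insert.prems m by (auto simp: mem_down_iff)
    then have "down x \<inter> down m \<noteq> {}" by auto
    with meet[of x m] insert.prems m
    obtain n where n: "n \<in> pverts G" "down x \<inter> down m = down n" by auto
    then have "n \<in> ?U" using uv_mem by (simp add: mem_down_iff)
    moreover have "below G n x" "below G n m"
      using n below_refl[of n] by (auto simp: set_eq_iff mem_down_iff)
    ultimately show ?case using m below_trans[of n m] by auto
  qed
  from this[of ?U] obtain m where "m \<in> ?U" "\<forall>x \<in> ?U. below G m x"
    using pair_finite_verts by auto
  then show "\<exists>m. is_lub {u, v} m" unfolding is_lub_def by blast
qed

text \<open>For \<open>x \<noteq> y\<close> only principal ideals can contain both, and the least of
  these is generated by the join. For \<open>x = y\<close> the least member is the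
  singleton.\<close>

lemma (in dag) global_imp_pre_binary_ideals:
  assumes "global_lca_property G"
  shows "pre_binary (pverts G) ideals"
  unfolding pre_binary_iff[OF finite_ideals]
proof (intro ballI)
  fix x y assume xy: "x \<in> pverts G" "y \<in> pverts G"
  show "\<exists>C \<in> ideals. x \<in> C \<and> y \<in> C \<and> (\<forall>D \<in> ideals. x \<in> D \<and> y \<in> D \<longrightarrow> C \<subseteq> D)"
  proof (cases "x = y")
    case True
    with xy show ?thesis unfolding ideals_def by blast
  next
    case False
    obtain m where m: "is_lub {x, y} m"
      using assms xy unfolding global_iff_pairwise_lub by blast
    have "down m \<subseteq> D" if D: "D \<in> ideals" "x \<in> D" "y \<in> D" for D
    proof -
      have "D \<in> down ` pverts G" using D False unfolding ideals_def by auto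
      then obtain v where v: "v \<in> pverts G" "D = down v" by (auto elim: imageE)
      with D m have "below G m v" by (simp add: is_lub_def mem_down_iff)
      then show ?thesis using v m by (simp add: is_lub_def down_mono_iff)
    qed
    with m show ?thesis unfolding ideals_def is_lub_def
      by (intro bexI[of _ "down m"]) (auto simp: mem_down_iff)
  qed
qed

text \<open>The least member containing two distinct vertices is no singleton, hence some
  \<open>down m\<close>. Comparing it with \<open>down v\<close> for each common upper bound
  \<open>v\<close> shows that \<open>m\<close> is the join.\<close>

lemma (in dag) pre_binary_ideals_imp_global:
  assumes "pre_binary (pverts G) ideals"
  shows "global_lca_property G"
  unfolding global_iff_pairwise_lub
proof (intro ballI)
  fix x y assume xy: "x \<in> pverts G" "y \<in> pverts G"
  show "\<exists>m. is_lub {x, y} m"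
  proof (cases "x = y")
    case True
    with xy show ?thesis using is_lub_singleton by auto
  next
    case False
    from assms[unfolded pre_binary_iff[OF finite_ideals], rule_format, OF xy]
    obtain C where C: "C \<in> ideals" "x \<in> C" "y \<in> C"
      and least: "\<And>D. \<lbrakk>D \<in> ideals; x \<in> D; y \<in> D\<rbrakk> \<Longrightarrow> C \<subseteq> D"
      by metis
    have "C \<in> down ` pverts G" using C False unfolding ideals_def by auto
    then obtain m where m: "m \<in> pverts G" "C = down m" by (auto elim: imageE)
    have "below G m v" if "v \<in> pverts G" "below G x v" "below G y v" for v
      using least[of "down v"] that m by (simp add: ideals_def down_mono_iff mem_down_iff)
    with C m show ?thesis unfolding is_lub_def by (auto simp: mem_down_iff)
  qed
qed

section \<open>The reachability order of the leaf-extended DAG\<close>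

lemma (in dag) mem_leaves_iff: "v \<in> leaves G \<longleftrightarrow> v \<in> pverts G \<and> (\<forall>x. below G x v \<longrightarrow> x = v)"
  unfolding leaves_def minimal_elems_def using below_verts by blast

lemma (in dag) mem_verts_lxt [simp]:
  "Inl v \<in> pverts (lxt G) \<longleftrightarrow> v \<in> pverts G"
  "Inr v \<in> pverts (lxt G) \<longleftrightarrow> v \<in> inner"
  unfolding lxt_def by auto

lemma (in dag) mem_arcs_lxt:
  "(x, y) \<in> parcs (lxt G) \<longleftrightarrow>
    (\<exists>u v. x = Inl u \<and> y = Inl v \<and> (u, v) \<in> parcs G) \<or>
    (\<exists>v \<in> inner. x = Inl v \<and> y = Inr v)"
  unfolding lxt_def by force

lemma (in dag) inner_subset: "inner \<subseteq> pverts G"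
  unfolding Defs.inner_verts_def by blast

text \<open>New vertices have no outgoing arcs, so a path from an old vertex runs inside the copy of
  \<open>G\<close>, except perhaps for a last step to a new leaf, and a path from a new vertex is
  trivial.\<close>

lemma (in dag) below_lxt_cases:
  assumes "below (lxt G) y x"
  shows "(\<exists>u v. x = Inl v \<and> y = Inl u \<and> below G u v) \<or>
    (\<exists>u v. x = Inl v \<and> y = Inr u \<and> u \<in> inner \<and> below G u v) \<or>
    (\<exists>v \<in> inner. x = Inr v \<and> y = Inr v)"
proof -
  have "(x, y) \<in> rtrancl_on (pverts (lxt G)) (parcs (lxt G))"
    using assms unfolding below_def reachable_def by simp
  then show ?thesis
  proof (induction rule: rtrancl_on_induct)
    case base
    then show ?case by (cases x) (auto simp: below_refl)
  next
    case (step y z)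
    have "below G w v" if "(u, w) \<in> parcs G" "below G u v" for u v w
      using that reachable_adj_trans unfolding below_def by simp
    with step show ?case by (auto simp: mem_arcs_lxt)
  qed
qed

lemma (in dag) below_lxt_Inl_Inl:
  assumes "below G u v"
  shows "below (lxt G) (Inl u) (Inl v)"
proof -
  have "(v, u) \<in> rtrancl_on (pverts G) (parcs G)"
    using assms unfolding below_def reachable_def by simp
  then have "(Inl v, Inl u) \<in> rtrancl_on (pverts (lxt G)) (parcs (lxt G))"
    by (induction rule: rtrancl_on_induct)
      (auto simp: mem_arcs_lxt intro: rtrancl_on_into_rtrancl_on)
  then show ?thesis unfolding below_def reachable_def by simp
qed

lemma (in dag) below_lxt_Inr_Inl:
  assumes "u \<in> inner" "below G u v"
  shows "below (lxt G) (Inr u) (Inl v)"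
proof -
  have "(Inl v, Inl u) \<in> rtrancl_on (pverts (lxt G)) (parcs (lxt G))"
    using below_lxt_Inl_Inl[OF assms(2)] unfolding below_def reachable_def by simp
  then have "(Inl v, Inr u) \<in> rtrancl_on (pverts (lxt G)) (parcs (lxt G))"
    by (rule rtrancl_on_into_rtrancl_on) (use assms in \<open>auto simp: mem_arcs_lxt\<close>)
  then show ?thesis unfolding below_def reachable_def by simp
qed

lemma (in dag) below_lxt_simps [simp]:
  "below (lxt G) (Inl u) (Inl v) \<longleftrightarrow> below G u v"
  "below (lxt G) (Inr u) (Inl v) \<longleftrightarrow> u \<in> inner \<and> below G u v"
  "below (lxt G) (Inr u) (Inr v) \<longleftrightarrow> u = v \<and> v \<in> inner"
  "\<not> below (lxt G) (Inl u) (Inr v)"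
proof -
  show "below (lxt G) (Inl u) (Inl v) \<longleftrightarrow> below G u v"
    using below_lxt_cases[of "Inl u" "Inl v"] below_lxt_Inl_Inl[of u v] by auto
  show "below (lxt G) (Inr u) (Inl v) \<longleftrightarrow> u \<in> inner \<and> below G u v"
    using below_lxt_cases[of "Inr u" "Inl v"] below_lxt_Inr_Inl[of u v] by auto
  show "below (lxt G) (Inr u) (Inr v) \<longleftrightarrow> u = v \<and> v \<in> inner"
    using below_lxt_cases[of "Inr u" "Inr v"] by (auto simp: below_def reachable_def)
  show "\<not> below (lxt G) (Inl u) (Inr v)"
    using below_lxt_cases[of "Inl u" "Inr v"] by auto
qed

section \<open>Leaves and clusters of the leaf-extended DAG\<close>

definition (in dag) rep :: "'a \<Rightarrow> 'a + 'a" where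
  "rep v = (if v \<in> inner then Inr v else Inl v)"

text \<open>A left inverse of \<open>rep\<close>, but defined on all vertices of
  \<open>lxt G\<close>: it also sends the copy \<open>Inl v\<close> of an inner vertex to
  \<open>v\<close>.\<close>

definition (in dag) base :: "'a + 'a \<Rightarrow> 'a" where
  "base = case_sum id id"

lemma (in dag) base_simps [simp]: "base (Inl v) = v" "base (Inr v) = v" "base (rep v) = v"
  unfolding base_def rep_def by auto

lemma (in dag) inj_rep: "inj rep"
  by (rule inj_on_inverseI[of _ base]) simp

lemma (in dag) leaves_lxt: "leaves (lxt G) = rep ` pverts G"
proof -
  have "Inl v \<in> leaves (lxt G) \<longleftrightarrow> v \<in> leaves G" for v
  proof
    assume l: "Inl v \<in> leaves (lxt G)"
    then have v: "v \<in> pverts G" unfolding leaves_def minimal_elems_def by simp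
    have "v \<notin> inner"
    proof
      assume "v \<in> inner"
      then have "below (lxt G) (Inr v) (Inl v)" "Inr v \<in> pverts (lxt G)"
        using v below_refl by auto
      with l show False unfolding leaves_def minimal_elems_def by blast
    qed
    with v show "v \<in> leaves G" unfolding Defs.inner_verts_def by blast
  next
    assume v: "v \<in> leaves G"
    have "x = Inl v" if "below (lxt G) x (Inl v)" for x
      using that v by (cases x) (auto simp: mem_leaves_iff Defs.inner_verts_def)
    with v show "Inl v \<in> leaves (lxt G)"
      by (auto simp: leaves_def minimal_elems_def)
  qed
  moreover have "Inr v \<in> leaves (lxt G) \<longleftrightarrow> v \<in> inner" for v
  proof -
    have "x = Inr v" if "below (lxt G) x (Inr v)" for x
      using that by (cases x) auto
    then show ?thesis by (auto simp: leaves_def minimal_elems_def)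
  qed
  ultimately have "x \<in> leaves (lxt G) \<longleftrightarrow> x \<in> rep ` pverts G" for x
    using inner_subset
    by (cases x) (auto simp: rep_def image_iff Defs.inner_verts_def mem_leaves_iff)
  then show ?thesis by blast
qed

lemma (in dag) cluster_lxt_Inl: "cluster (lxt G) (Inl v) = rep ` down v"
proof -
  have "below (lxt G) (rep u) (Inl v) \<longleftrightarrow> below G u v" for u
    by (simp add: rep_def)
  then show ?thesis
    unfolding cluster_def leaves_lxt down_def using below_verts by auto
qed

lemma (in dag) cluster_lxt_Inr:
  assumes "v \<in> inner"
  shows "cluster (lxt G) (Inr v) = rep ` {v}"
proof -
  have "below (lxt G) (rep u) (Inr v) \<longleftrightarrow> u = v" for u
    using assms by (auto simp: rep_def)
  then show ?thesis
    using assms inner_subset unfolding cluster_def leaves_lxt by auto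
qed

lemma (in dag) clusters_lxt: "clusters (lxt G) = (`) rep ` ideals"
proof -
  \<comment> \<open>At a leaf \<open>v\<close> of \<open>G\<close> the singleton is already a
    principal ideal. This leaves one singleton per inner vertex, matching the clusters of the new
    leaves.\<close>
  have "{v} \<in> down ` pverts G" if "v \<in> pverts G - inner" for v
  proof -
    have "down v = {v}"
      using that below_refl by (auto simp: Defs.inner_verts_def mem_leaves_iff mem_down_iff)
    with that show ?thesis by (metis DiffD1 imageI)
  qed
  then have ideals: "ideals = down ` pverts G \<union> (\<lambda>v. {v}) ` inner"
    unfolding ideals_def using inner_subset by blast
  have "clusters (lxt G) =
      (\<lambda>v. cluster (lxt G) (Inl v)) ` pverts G \<union> (\<lambda>v. cluster (lxt G) (Inr v)) ` inner"
    unfolding clusters_def by (simp add: lxt_def image_Un image_image)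
  also have "\<dots> = (\<lambda>v. rep ` down v) ` pverts G \<union> (\<lambda>v. rep ` {v}) ` inner"
    using cluster_lxt_Inl cluster_lxt_Inr by (intro arg_cong2[where f = "(\<union>)"] image_cong) auto
  finally show ?thesis unfolding ideals by (simp add: image_Un image_image)
qed

section \<open>Least common ancestors in the leaf-extended DAG\<close>

text \<open>A new leaf has only itself below it, so it is a common ancestor of no non-empty set
  other than its own singleton. All common ancestors are thus old vertices, and for these
  \<open>Inr v\<close> and \<open>Inl v\<close> impose the same condition when \<open>v\<close> is
  inner.\<close>

lemma (in dag) LCA_lxt:
  assumes "A \<subseteq> pverts (lxt G)" "A \<noteq> {}" "\<And>v. A \<noteq> {Inr v}"
  shows "LCA (lxt G) A = Inl ` LCA G (base ` A)"
proof -
  let ?S = "{v \<in> pverts G. \<forall>a \<in> base ` A. below G a v}"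
  have inr: "a \<in> inner" if "Inr a \<in> A" for a
    using that assms(1) by auto
  have Inl: "(\<forall>a \<in> A. below (lxt G) a (Inl v)) \<longleftrightarrow> (\<forall>a \<in> base ` A. below G a v)" for v
  proof -
    have "below (lxt G) a (Inl v) \<longleftrightarrow> below G (base a) v" if "a \<in> A" for a
      using that inr by (cases a) auto
    then show ?thesis by simp
  qed
  have Inr: "\<not> (\<forall>a \<in> A. below (lxt G) a (Inr v))" for v
  proof
    assume *: "\<forall>a \<in> A. below (lxt G) a (Inr v)"
    have "a = Inr v" if "a \<in> A" for a
      using *[rule_format, OF that] by (cases a) auto
    then show False using assms(2,3) by blast
  qed
  have "{x \<in> pverts (lxt G). \<forall>a \<in> A. below (lxt G) a x} = Inl ` ?S"
  proof (intro set_eqI)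
    fix x show "x \<in> {x \<in> pverts (lxt G). \<forall>a \<in> A. below (lxt G) a x} \<longleftrightarrow> x \<in> Inl ` ?S"
      using Inl Inr by (cases x) (auto simp: image_iff)
  qed
  then show ?thesis unfolding LCA_def minimal_elems_def by auto
qed

lemma (in dag) global_imp_global_lxt:
  assumes "global_lca_property G"
  shows "global_lca_property (lxt G)"
  unfolding global_lca_property_def
proof (intro allI impI)
  fix A assume A: "A \<subseteq> pverts (lxt G)" "A \<noteq> {}"
  show "card (LCA (lxt G) A) = 1"
  proof (cases "\<exists>v. A = {Inr v}")
    case True
    then obtain v where v: "A = {Inr v}" by blast
    then have inr: "v \<in> inner" using A by simp
    have "minimal_elems (below (lxt G)) {x \<in> pverts (lxt G). below (lxt G) (Inr v) x} = {Inr v}"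
    proof -
      have "x = Inr v" if "below (lxt G) x (Inr v)" for x
        using that by (cases x) auto
      moreover have "Inr v \<in> pverts (lxt G)" "below (lxt G) (Inr v) (Inr v)" using inr by auto
      ultimately show ?thesis unfolding minimal_elems_def by blast
    qed
    then show ?thesis using v unfolding LCA_def by simp
  next
    case False
    have "base ` A \<subseteq> pverts G"
    proof
      fix v assume "v \<in> base ` A"
      then obtain x where x: "x \<in> A" "v = base x" by blast
      then have "x \<in> pverts (lxt G)" using A by blast
      then show "v \<in> pverts G" using x inner_subset by (cases x) auto
    qed
    \<comment> \<open>\<open>base\<close> may merge \<open>Inl v\<close> with \<open>Inr v\<close>,
      which is harmless because the global property covers non-empty sets of every size.\<close>
    then have "card (LCA G (base ` A)) = 1"
      using assms A unfolding global_lca_property_def by simp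
    then show ?thesis using LCA_lxt A False by (simp add: card_image)
  qed
qed

text \<open>Every vertex of \<open>G\<close> is represented by a leaf of \<open>lxt G\<close>, so
  two distinct vertices become a pair of leaves, whose least common ancestors are the copies of
  those of the original pair.\<close>

lemma (in dag) pairwise_lxt_imp_global:
  assumes "pairwise_lca_property (lxt G)"
  shows "global_lca_property G"
  unfolding global_iff_pairwise_lub
proof (intro ballI)
  fix u v assume uv: "u \<in> pverts G" "v \<in> pverts G"
  show "\<exists>m. is_lub {u, v} m"
  proof (cases "u = v")
    case True
    with uv show ?thesis using is_lub_singleton by auto
  next
    case False
    then have ne: "rep u \<noteq> rep v" using inj_rep by (simp add: inj_eq)
    let ?A = "{rep u, rep v}"
    have sub: "?A \<subseteq> leaves (lxt G)" using uv leaves_lxt by blast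
    have "card ?A = 2" using ne by simp
    with sub assms have "card (LCA (lxt G) ?A) = 1"
      unfolding pairwise_lca_property_def by blast
    moreover have "LCA (lxt G) ?A = Inl ` LCA G (base ` ?A)"
    proof (rule LCA_lxt)
      show "?A \<subseteq> pverts (lxt G)" using sub unfolding leaves_def minimal_elems_def by blast
      show "?A \<noteq> {Inr w}" for w using ne by auto
    qed simp
    ultimately have "card (LCA G {u, v}) = 1" by (simp add: card_image)
    then show ?thesis using card_LCA_iff by blast
  qed
qed

section \<open>The cluster conditions on the leaf-extended DAG\<close>

lemma (in dag) clustering_system_lxt_iff:
  "clustering_system (leaves (lxt G)) (clusters (lxt G)) \<longleftrightarrow> clustering_system (pverts G) ideals"
  unfolding leaves_lxt clusters_lxt using inj_rep by (rule clustering_system_image_iff)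

lemma (in dag) global_iff_clustering_closed_lxt:
  "global_lca_property G \<longleftrightarrow>
    clustering_system (leaves (lxt G)) (clusters (lxt G)) \<and> closed_system (clusters (lxt G))"
  \<comment> \<open>The clustering-system equivalence is applied first, as its left-hand side
    mentions \<open>clusters (lxt G)\<close>, which the second unfolding replaces.\<close>
  unfolding clustering_system_lxt_iff unfolding clusters_lxt closed_system_image_iff[OF inj_rep]
  using global_imp_clustering_system_ideals global_imp_closed_ideals clustering_closed_imp_global
  by iprover

lemma (in dag) global_iff_clustering_pre_binary_lxt:
  "global_lca_property G \<longleftrightarrow>
    clustering_system (leaves (lxt G)) (clusters (lxt G)) \<and>
    pre_binary (leaves (lxt G)) (clusters (lxt G))"
  unfolding clustering_system_lxt_iff
  unfolding leaves_lxt clusters_lxt pre_binary_image_iff[OF inj_rep finite_ideals]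
  using global_imp_clustering_system_ideals global_imp_pre_binary_ideals
    pre_binary_ideals_imp_global
  by iprover

theorem theorem6p7:
  fixes G :: "'a pair_pre_digraph"
  assumes "dag G"
  shows
    "(global_lca_property G \<longleftrightarrow> global_lca_property (lxt G)) \<and>
     (global_lca_property G \<longleftrightarrow> global_pairwise_lca_property (lxt G)) \<and>
     (global_lca_property G \<longleftrightarrow> lca_property (lxt G)) \<and>
     (global_lca_property G \<longleftrightarrow> pairwise_lca_property (lxt G)) \<and>
     (global_lca_property G \<longleftrightarrow>
        clustering_system (leaves (lxt G)) (clusters (lxt G)) \<and> closed_system (clusters (lxt G))) \<and>
     (global_lca_property G \<longleftrightarrow>
        clustering_system (leaves (lxt G)) (clusters (lxt G)) \<and>
        pre_binary (leaves (lxt G)) (clusters (lxt G)))"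
  \<comment> \<open>The lca-properties close a cycle: from global on \<open>G\<close> to global on
    \<open>lxt G\<close>, then through either the global pairwise or the leaf version to the
    pairwise one, and back to \<open>G\<close>.\<close>
  using dag.global_imp_global_lxt[OF assms] dag.pairwise_lxt_imp_global[OF assms]
    dag.global_iff_clustering_closed_lxt[OF assms]
    dag.global_iff_clustering_pre_binary_lxt[OF assms]
    global_lca_imp_lca_property[of "lxt G"] global_lca_imp_global_pairwise[of "lxt G"]
    lca_property_imp_pairwise[of "lxt G"] global_pairwise_imp_pairwise[of "lxt G"]
  by satx

end
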